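(* Let $\mathbb{C}$ be a Cartesian differential category with differential combinator $\mathbf{D}$ and tangent bundle functor $\mathbf{T}$, and let $\mathbf{fix}$ be a Conway operator on $\mathbb{C}$. Then the following are equivalent: (i) $\mathbf{fix}$ satisfies the differential-fixpoint rule: for every map $f: A\times X\to X$, $\mathbf{D}[\mathbf{fix}^X_A(f)] = \pi_2\circ \mathbf{fix}^{\mathbf{T}X}_{\mathbf{T}A}(\mathbf{T}(f)\circ c)$; (ii) $\mathbf{fix}$ satisfies the tangent-fixpoint rule: for every map $f: A\times X\to X$, $\mathbf{T}(\mathbf{fix}^X_A(f)) = \mathbf{fix}^{\mathbf{T}X}_{\mathbf{T}A}(\mathbf{T}(f)\circ c)$; (iii) $\mathbf{fix}$ satisfies the strong differential-fixpoint rule: for every map $f: A\times X\to X$, $\mathbf{D}[\mathbf{fix}^X_A(f)] = \mathbf{fix}^X_{A\times A}\big(\mathbf{D}[f]\circ\langle \pi_1, \mathbf{fix}^X_A(f)\circ\pi_1, \pi_2,\pi_3\rangle\big)$, where $\pi_1,\pi_2,\pi_3$ are the projections from $A\times A\times X$.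
   Context: A left additive category is a category whose hom-sets are commutative monoids $(+,0)$ with $(f+g)\circ x=f\circ x+g\circ x$ and $0\circ x=0$. A map $f$ is additive if $f\circ(x+y)=f\circ x+f\circ y$ and $f\circ 0=0$. A Cartesian left additive category is a left additive category with finite products (terminal object $\top$, projections $\pi_j$, pairing $\langle -,\dots,-\rangle$) in which all projections are additive. A Cartesian differential category is a Cartesian left additive category $\mathbb{C}$ with a differential combinator: functions $\mathbf{D}:\mathbb{C}(A,B)\to\mathbb{C}(A\times A,B)$ such that: [CD.1] $\mathbf{D}[0]=0$, $\mathbf{D}[f+g]=\mathbf{D}[f]+\mathbf{D}[g]$; [CD.2] $\mathbf{D}[f]\circ\langle x,0\rangle=0$, $\mathbf{D}[f]\circ\langle x,y+z\rangle=\mathbf{D}[f]\circ\langle x,y\rangle+\mathbf{D}[f]\circ\langle x,z\rangle$; [CD.3] $\mathbf{D}[1_A]=\pi_2$, $\mathbf{D}[\pi_j]=\pi_j\circ\pi_2$; [CD.4] $\mathbf{D}[\langle f_1,\dots,f_n\rangle]=\langle\mathbf{D}[f_1],\dots,\mathbf{D}[f_n]\rangle$; [CD.5] $\mathbf{D}[g\circ f]=\mathbf{D}[g]\circ\langle f\circ\pi_1,\mathbf{D}[f]\rangle$; [CD.6] $\mathbf{D}[\mathbf{D}[f]]\circ\langle x,y,0,z\rangle=\mathbf{D}[f]\circ\langle x,z\rangle$; [CD.7] $\mathbf{D}[\mathbf{D}[f]]\circ\langle x,y,z,0\rangle=\mathbf{D}[\mathbf{D}[f]]\circ\langle x,z,y,0\rangle$.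 The tangent bundle functor $\mathbf{T}:\mathbb{C}\to\mathbb{C}$ is $\mathbf{T}(A)=A\times A$, $\mathbf{T}(f)=\langle f\circ\pi_1,\mathbf{D}[f]\rangle$. Write $c=\langle\pi_1,\pi_3,\pi_2,\pi_4\rangle:A\times B\times C\times D\to A\times C\times B\times D$ for the isomorphism swapping the middle two factors. A parametrized fixpoint operator on a category with finite products is a family of functions $\mathbf{fix}^X_A:\mathbb{C}(A\times X,X)\to\mathbb{C}(A,X)$ with (fixpoint axiom) $f\circ\langle 1_A,\mathbf{fix}^X_A(f)\rangle=\mathbf{fix}^X_A(f)$ for all $f:A\times X\to X$, and (naturality) $\mathbf{fix}^X_B(f)\circ g=\mathbf{fix}^X_A(f\circ(g\times 1_X))$ for all $g:A\to B$, $f:B\times X\to X$. A Conway operator is a parametrized fixpoint operator that also satisfies (dinaturality) $\mathbf{fix}^X_A(g\circ f)=g\circ\mathbf{fix}^Y_A(f\circ(1_A\times g))$ for all $f:A\times X\to Y$, $g:Y\to X$; and (Bekič) for all $f:A\times X\times Y\to X$, $g:A\times X\times Y\to Y$, $\mathbf{fix}^{X\times Y}_A(\langle f,g\rangle)=\langle l,\mathbf{fix}^Y_A(g\circ(\langle 1_A,l\rangle\times 1_Y))\rangle$ where $l=\mathbf{fix}^X_A\big(f\circ\langle 1_{A\times X},\mathbf{fix}^Y_{A\times X}(g)\rangle\big):A\to X$. *)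

theory Defs
  imports Main
begin

record ('o, 'm) category =
  Ob :: "'o set"
  Arr :: "'m set"
  Dom :: "'m \<Rightarrow> 'o"
  Cod :: "'m \<Rightarrow> 'o"
  Ident :: "'o \<Rightarrow> 'm" ("\<one>\<index>")
  Comp :: "'m \<Rightarrow> 'm \<Rightarrow> 'm" (infixr "\<^bold>\<circ>\<index>" 70)

definition hom :: "('o, 'm, 'x) category_scheme \<Rightarrow> 'o \<Rightarrow> 'o \<Rightarrow> 'm set" where
  "hom C A B = {f \<in> Arr C. Dom C f = A \<and> Cod C f = B}"

locale category =
  fixes C :: "('o, 'm, 'x) category_scheme" (structure)
  assumes Dom_Ob: "f \<in> Arr C \<Longrightarrow> Dom C f \<in> Ob C"
    and Cod_Ob: "f \<in> Arr C \<Longrightarrow> Cod C f \<in> Ob C"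
    and Ident_hom: "A \<in> Ob C \<Longrightarrow> \<one> A \<in> hom C A A"
    and Comp_hom: "\<lbrakk>f \<in> hom C A B; g \<in> hom C B E\<rbrakk> \<Longrightarrow> g \<^bold>\<circ> f \<in> hom C A E"
    and Comp_Ident: "f \<in> hom C A B \<Longrightarrow> f \<^bold>\<circ> \<one> A = f"
    and Ident_Comp: "f \<in> hom C A B \<Longrightarrow> \<one> B \<^bold>\<circ> f = f"
    and Comp_assoc: "\<lbrakk>f \<in> hom C A B; g \<in> hom C B E; h \<in> hom C E F\<rbrakk>
      \<Longrightarrow> (h \<^bold>\<circ> g) \<^bold>\<circ> f = h \<^bold>\<circ> (g \<^bold>\<circ> f)"

text \<open>
  Finite products are given by a chosen terminal object and chosen binary products; longer
  products are bracketed binary ones and the reassociations between bracketings are written out.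
\<close>

record ('o, 'm) product_category = "('o, 'm) category" +
  Top :: 'o ("\<^bold>\<top>\<index>")
  Prod :: "'o \<Rightarrow> 'o \<Rightarrow> 'o" (infixr "\<^bold>\<times>\<index>" 80)
  Proj1 :: "'o \<Rightarrow> 'o \<Rightarrow> 'm" ("\<pi>\<^sub>1\<index>")
  Proj2 :: "'o \<Rightarrow> 'o \<Rightarrow> 'm" ("\<pi>\<^sub>2\<index>")
  Pairing :: "'m \<Rightarrow> 'm \<Rightarrow> 'm" ("\<langle>_, _\<rangle>\<index>")

locale category_with_finite_products = category C
  for C :: "('o, 'm, 'x) product_category_scheme" (structure) +
  assumes Top_Ob: "\<^bold>\<top> \<in> Ob C"
    and Top_terminal: "A \<in> Ob C \<Longrightarrow> \<exists>!f. f \<in> hom C A \<^bold>\<top>"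
    and Prod_Ob: "\<lbrakk>A \<in> Ob C; B \<in> Ob C\<rbrakk> \<Longrightarrow> A \<^bold>\<times> B \<in> Ob C"
    and Proj1_hom: "\<lbrakk>A \<in> Ob C; B \<in> Ob C\<rbrakk> \<Longrightarrow> \<pi>\<^sub>1 A B \<in> hom C (A \<^bold>\<times> B) A"
    and Proj2_hom: "\<lbrakk>A \<in> Ob C; B \<in> Ob C\<rbrakk> \<Longrightarrow> \<pi>\<^sub>2 A B \<in> hom C (A \<^bold>\<times> B) B"
    and Pairing_hom: "\<lbrakk>f \<in> hom C Z A; g \<in> hom C Z B\<rbrakk> \<Longrightarrow> \<langle>f, g\<rangle> \<in> hom C Z (A \<^bold>\<times> B)"
    and Proj1_Pairing: "\<lbrakk>f \<in> hom C Z A; g \<in> hom C Z B\<rbrakk> \<Longrightarrow> \<pi>\<^sub>1 A B \<^bold>\<circ> \<langle>f, g\<rangle> = f"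
    and Proj2_Pairing: "\<lbrakk>f \<in> hom C Z A; g \<in> hom C Z B\<rbrakk> \<Longrightarrow> \<pi>\<^sub>2 A B \<^bold>\<circ> \<langle>f, g\<rangle> = g"
    and Pairing_unique: "\<lbrakk>A \<in> Ob C; B \<in> Ob C; h \<in> hom C Z (A \<^bold>\<times> B)\<rbrakk>
      \<Longrightarrow> \<langle>\<pi>\<^sub>1 A B \<^bold>\<circ> h, \<pi>\<^sub>2 A B \<^bold>\<circ> h\<rangle> = h"

text \<open>The map \<open>f \<times> g\<close> between products.\<close>

definition prod_map :: "('o, 'm, 'x) product_category_scheme \<Rightarrow> 'm \<Rightarrow> 'm \<Rightarrow> 'm"
    (infixr "\<^bold>\<otimes>\<index>" 75) where
  "f \<^bold>\<otimes>\<^bsub>C\<^esub> g =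
    \<langle>f \<^bold>\<circ>\<^bsub>C\<^esub> \<pi>\<^sub>1\<^bsub>C\<^esub> (Dom C f) (Dom C g), g \<^bold>\<circ>\<^bsub>C\<^esub> \<pi>\<^sub>2\<^bsub>C\<^esub> (Dom C f) (Dom C g)\<rangle>\<^bsub>C\<^esub>"

text \<open>The associativity isomorphism from \<open>A \<times> (X \<times> Y)\<close> to \<open>(A \<times> X) \<times> Y\<close>.\<close>

definition assoc_iso :: "('o, 'm, 'x) product_category_scheme \<Rightarrow> 'o \<Rightarrow> 'o \<Rightarrow> 'o \<Rightarrow> 'm" where
  "assoc_iso C A X Y =
    \<langle>\<langle>\<pi>\<^sub>1\<^bsub>C\<^esub> A (X \<^bold>\<times>\<^bsub>C\<^esub> Y),
      \<pi>\<^sub>1\<^bsub>C\<^esub> X Y \<^bold>\<circ>\<^bsub>C\<^esub> \<pi>\<^sub>2\<^bsub>C\<^esub> A (X \<^bold>\<times>\<^bsub>C\<^esub> Y)\<rangle>\<^bsub>C\<^esub>,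
     \<pi>\<^sub>2\<^bsub>C\<^esub> X Y \<^bold>\<circ>\<^bsub>C\<^esub> \<pi>\<^sub>2\<^bsub>C\<^esub> A (X \<^bold>\<times>\<^bsub>C\<^esub> Y)\<rangle>\<^bsub>C\<^esub>"

text \<open>The interchange \<open>c\<close>, bracketed as a map from \<open>(A \<times> B) \<times> (E \<times> F)\<close> to
  \<open>(A \<times> E) \<times> (B \<times> F)\<close>.\<close>

definition interchange ::
  "('o, 'm, 'x) product_category_scheme \<Rightarrow> 'o \<Rightarrow> 'o \<Rightarrow> 'o \<Rightarrow> 'o \<Rightarrow> 'm" where
  "interchange C A B E F =
    (let p = \<pi>\<^sub>1\<^bsub>C\<^esub> (A \<^bold>\<times>\<^bsub>C\<^esub> B) (E \<^bold>\<times>\<^bsub>C\<^esub> F); q = \<pi>\<^sub>2\<^bsub>C\<^esub> (A \<^bold>\<times>\<^bsub>C\<^esub> B) (E \<^bold>\<times>\<^bsub>C\<^esub> F)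
     in \<langle>\<langle>\<pi>\<^sub>1\<^bsub>C\<^esub> A B \<^bold>\<circ>\<^bsub>C\<^esub> p, \<pi>\<^sub>1\<^bsub>C\<^esub> E F \<^bold>\<circ>\<^bsub>C\<^esub> q\<rangle>\<^bsub>C\<^esub>,
         \<langle>\<pi>\<^sub>2\<^bsub>C\<^esub> A B \<^bold>\<circ>\<^bsub>C\<^esub> p, \<pi>\<^sub>2\<^bsub>C\<^esub> E F \<^bold>\<circ>\<^bsub>C\<^esub> q\<rangle>\<^bsub>C\<^esub>\<rangle>\<^bsub>C\<^esub>)"

record ('o, 'm) additive_category = "('o, 'm) product_category" +
  Zero :: "'o \<Rightarrow> 'o \<Rightarrow> 'm" ("\<zero>\<index>")
  Plus :: "'m \<Rightarrow> 'm \<Rightarrow> 'm" (infixl "\<^bold>+\<index>" 65)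

locale left_additive_category = category C
  for C :: "('o, 'm, 'x) additive_category_scheme" (structure) +
  assumes Zero_hom: "\<lbrakk>A \<in> Ob C; B \<in> Ob C\<rbrakk> \<Longrightarrow> \<zero> A B \<in> hom C A B"
    and Plus_hom: "\<lbrakk>f \<in> hom C A B; g \<in> hom C A B\<rbrakk> \<Longrightarrow> f \<^bold>+ g \<in> hom C A B"
    and Plus_assoc: "\<lbrakk>f \<in> hom C A B; g \<in> hom C A B; h \<in> hom C A B\<rbrakk>
      \<Longrightarrow> (f \<^bold>+ g) \<^bold>+ h = f \<^bold>+ (g \<^bold>+ h)"
    and Plus_commute: "\<lbrakk>f \<in> hom C A B; g \<in> hom C A B\<rbrakk> \<Longrightarrow> f \<^bold>+ g = g \<^bold>+ f"
    and Zero_Plus: "f \<in> hom C A B \<Longrightarrow> \<zero> A B \<^bold>+ f = f"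
    and Plus_Comp: "\<lbrakk>f \<in> hom C A B; g \<in> hom C A B; x \<in> hom C Z A\<rbrakk>
      \<Longrightarrow> (f \<^bold>+ g) \<^bold>\<circ> x = (f \<^bold>\<circ> x) \<^bold>+ (g \<^bold>\<circ> x)"
    and Zero_Comp: "\<lbrakk>B \<in> Ob C; x \<in> hom C Z A\<rbrakk> \<Longrightarrow> \<zero> A B \<^bold>\<circ> x = \<zero> Z B"

definition additive :: "('o, 'm, 'x) additive_category_scheme \<Rightarrow> 'm \<Rightarrow> bool" where
  "additive C f \<longleftrightarrow> f \<in> Arr C \<and>
    (\<forall>Z \<in> Ob C.
      (\<forall>x \<in> hom C Z (Dom C f). \<forall>y \<in> hom C Z (Dom C f).
        f \<^bold>\<circ>\<^bsub>C\<^esub> (x \<^bold>+\<^bsub>C\<^esub> y) = (f \<^bold>\<circ>\<^bsub>C\<^esub> x) \<^bold>+\<^bsub>C\<^esub> (f \<^bold>\<circ>\<^bsub>C\<^esub> y)) \<and>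
      f \<^bold>\<circ>\<^bsub>C\<^esub> \<zero>\<^bsub>C\<^esub> Z (Dom C f) = \<zero>\<^bsub>C\<^esub> Z (Cod C f))"

locale cartesian_left_additive_category =
  category_with_finite_products C + left_additive_category C
  for C :: "('o, 'm, 'x) additive_category_scheme" (structure) +
  assumes Proj1_additive: "\<lbrakk>A \<in> Ob C; B \<in> Ob C\<rbrakk> \<Longrightarrow> additive C (\<pi>\<^sub>1 A B)"
    and Proj2_additive: "\<lbrakk>A \<in> Ob C; B \<in> Ob C\<rbrakk> \<Longrightarrow> additive C (\<pi>\<^sub>2 A B)"

record ('o, 'm) differential_category = "('o, 'm) additive_category" +
  Diff :: "'m \<Rightarrow> 'm" ("\<^bold>D\<index>")

text \<open>
  For \<open>f : A \<rightarrow> B\<close> the map \<open>D (D f)\<close> has domain \<open>(A \<times> A) \<times> (A \<times> A)\<close>, which fixes the bracketing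
  of the quadruples in \<open>CD6\<close> and \<open>CD7\<close>.
\<close>

locale cartesian_differential_category = cartesian_left_additive_category C
  for C :: "('o, 'm, 'x) differential_category_scheme" (structure) +
  assumes Diff_hom: "f \<in> hom C A B \<Longrightarrow> \<^bold>D f \<in> hom C (A \<^bold>\<times> A) B"
    and CD1_Zero: "\<lbrakk>A \<in> Ob C; B \<in> Ob C\<rbrakk> \<Longrightarrow> \<^bold>D (\<zero> A B) = \<zero> (A \<^bold>\<times> A) B"
    and CD1_Plus: "\<lbrakk>f \<in> hom C A B; g \<in> hom C A B\<rbrakk> \<Longrightarrow> \<^bold>D (f \<^bold>+ g) = \<^bold>D f \<^bold>+ \<^bold>D g"
    and CD2_Zero: "\<lbrakk>f \<in> hom C A B; x \<in> hom C Z A\<rbrakk> \<Longrightarrow> \<^bold>D f \<^bold>\<circ> \<langle>x, \<zero> Z A\<rangle> = \<zero> Z B"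
    and CD2_Plus: "\<lbrakk>f \<in> hom C A B; x \<in> hom C Z A; y \<in> hom C Z A; z \<in> hom C Z A\<rbrakk>
      \<Longrightarrow> \<^bold>D f \<^bold>\<circ> \<langle>x, y \<^bold>+ z\<rangle> = (\<^bold>D f \<^bold>\<circ> \<langle>x, y\<rangle>) \<^bold>+ (\<^bold>D f \<^bold>\<circ> \<langle>x, z\<rangle>)"
    and CD3_Ident: "A \<in> Ob C \<Longrightarrow> \<^bold>D (\<one> A) = \<pi>\<^sub>2 A A"
    and CD3_Proj1: "\<lbrakk>A \<in> Ob C; B \<in> Ob C\<rbrakk>
      \<Longrightarrow> \<^bold>D (\<pi>\<^sub>1 A B) = \<pi>\<^sub>1 A B \<^bold>\<circ> \<pi>\<^sub>2 (A \<^bold>\<times> B) (A \<^bold>\<times> B)"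
    and CD3_Proj2: "\<lbrakk>A \<in> Ob C; B \<in> Ob C\<rbrakk>
      \<Longrightarrow> \<^bold>D (\<pi>\<^sub>2 A B) = \<pi>\<^sub>2 A B \<^bold>\<circ> \<pi>\<^sub>2 (A \<^bold>\<times> B) (A \<^bold>\<times> B)"
    and CD4: "\<lbrakk>f \<in> hom C Z A; g \<in> hom C Z B\<rbrakk> \<Longrightarrow> \<^bold>D \<langle>f, g\<rangle> = \<langle>\<^bold>D f, \<^bold>D g\<rangle>"
    and CD5: "\<lbrakk>f \<in> hom C A B; g \<in> hom C B E\<rbrakk>
      \<Longrightarrow> \<^bold>D (g \<^bold>\<circ> f) = \<^bold>D g \<^bold>\<circ> \<langle>f \<^bold>\<circ> \<pi>\<^sub>1 A A, \<^bold>D f\<rangle>"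
    and CD6: "\<lbrakk>f \<in> hom C A B; x \<in> hom C Z A; y \<in> hom C Z A; z \<in> hom C Z A\<rbrakk>
      \<Longrightarrow> \<^bold>D (\<^bold>D f) \<^bold>\<circ> \<langle>\<langle>x, y\<rangle>, \<langle>\<zero> Z A, z\<rangle>\<rangle> = \<^bold>D f \<^bold>\<circ> \<langle>x, z\<rangle>"
    and CD7: "\<lbrakk>f \<in> hom C A B; x \<in> hom C Z A; y \<in> hom C Z A; z \<in> hom C Z A\<rbrakk>
      \<Longrightarrow> \<^bold>D (\<^bold>D f) \<^bold>\<circ> \<langle>\<langle>x, y\<rangle>, \<langle>z, \<zero> Z A\<rangle>\<rangle> = \<^bold>D (\<^bold>D f) \<^bold>\<circ> \<langle>\<langle>x, z\<rangle>, \<langle>y, \<zero> Z A\<rangle>\<rangle>"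

definition tangent_ob :: "('o, 'm, 'x) differential_category_scheme \<Rightarrow> 'o \<Rightarrow> 'o" where
  "tangent_ob C A = A \<^bold>\<times>\<^bsub>C\<^esub> A"

definition tangent_map :: "('o, 'm, 'x) differential_category_scheme \<Rightarrow> 'm \<Rightarrow> 'm" where
  "tangent_map C f = \<langle>f \<^bold>\<circ>\<^bsub>C\<^esub> \<pi>\<^sub>1\<^bsub>C\<^esub> (Dom C f) (Dom C f), \<^bold>D\<^bsub>C\<^esub> f\<rangle>\<^bsub>C\<^esub>"

text \<open>\<open>Fix A X\<close> is the operator from maps \<open>A \<times> X \<rightarrow> X\<close> to maps \<open>A \<rightarrow> X\<close>.\<close>

locale parametrized_fixpoint_operator = category_with_finite_products C
  for C :: "('o, 'm, 'x) product_category_scheme" (structure) +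
  fixes Fix :: "'o \<Rightarrow> 'o \<Rightarrow> 'm \<Rightarrow> 'm"
  assumes Fix_hom: "\<lbrakk>A \<in> Ob C; X \<in> Ob C; f \<in> hom C (A \<^bold>\<times> X) X\<rbrakk> \<Longrightarrow> Fix A X f \<in> hom C A X"
    and fixpoint: "\<lbrakk>A \<in> Ob C; X \<in> Ob C; f \<in> hom C (A \<^bold>\<times> X) X\<rbrakk>
      \<Longrightarrow> f \<^bold>\<circ> \<langle>\<one> A, Fix A X f\<rangle> = Fix A X f"
    and naturality: "\<lbrakk>A \<in> Ob C; B \<in> Ob C; X \<in> Ob C; g \<in> hom C A B; f \<in> hom C (B \<^bold>\<times> X) X\<rbrakk>
      \<Longrightarrow> Fix B X f \<^bold>\<circ> g = Fix A X (f \<^bold>\<circ> (g \<^bold>\<otimes> \<one> X))"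

text \<open>In \<open>bekic\<close> the triple product is read as \<open>(A \<times> X) \<times> Y\<close>, so that \<open>\<langle>f, g\<rangle>\<close> has to be
  reassociated before the fixpoint over \<open>X \<times> Y\<close> is taken.\<close>

locale conway_operator = parametrized_fixpoint_operator C Fix
  for C :: "('o, 'm, 'x) product_category_scheme" (structure) and Fix +
  assumes dinaturality:
    "\<lbrakk>A \<in> Ob C; X \<in> Ob C; Y \<in> Ob C; f \<in> hom C (A \<^bold>\<times> X) Y; g \<in> hom C Y X\<rbrakk>
      \<Longrightarrow> Fix A X (g \<^bold>\<circ> f) = g \<^bold>\<circ> Fix A Y (f \<^bold>\<circ> (\<one> A \<^bold>\<otimes> g))"
    and bekic:
    "\<lbrakk>A \<in> Ob C; X \<in> Ob C; Y \<in> Ob C;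
      f \<in> hom C ((A \<^bold>\<times> X) \<^bold>\<times> Y) X; g \<in> hom C ((A \<^bold>\<times> X) \<^bold>\<times> Y) Y;
      l = Fix A X (f \<^bold>\<circ> \<langle>\<one> (A \<^bold>\<times> X), Fix (A \<^bold>\<times> X) Y g\<rangle>)\<rbrakk>
      \<Longrightarrow> Fix A (X \<^bold>\<times> Y) (\<langle>f, g\<rangle> \<^bold>\<circ> assoc_iso C A X Y) =
            \<langle>l, Fix A Y (g \<^bold>\<circ> (\<langle>\<one> A, l\<rangle> \<^bold>\<otimes> \<one> Y))\<rangle>"

definition differential_fixpoint_rule ::
  "('o, 'm, 'x) differential_category_scheme \<Rightarrow> ('o \<Rightarrow> 'o \<Rightarrow> 'm \<Rightarrow> 'm) \<Rightarrow> bool" where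
  "differential_fixpoint_rule C Fix \<longleftrightarrow>
    (\<forall>A \<in> Ob C. \<forall>X \<in> Ob C. \<forall>f \<in> hom C (A \<^bold>\<times>\<^bsub>C\<^esub> X) X.
      \<^bold>D\<^bsub>C\<^esub> (Fix A X f) =
        \<pi>\<^sub>2\<^bsub>C\<^esub> X X \<^bold>\<circ>\<^bsub>C\<^esub>
          Fix (tangent_ob C A) (tangent_ob C X) (tangent_map C f \<^bold>\<circ>\<^bsub>C\<^esub> interchange C A A X X))"

definition tangent_fixpoint_rule ::
  "('o, 'm, 'x) differential_category_scheme \<Rightarrow> ('o \<Rightarrow> 'o \<Rightarrow> 'm \<Rightarrow> 'm) \<Rightarrow> bool" where
  "tangent_fixpoint_rule C Fix \<longleftrightarrow>
    (\<forall>A \<in> Ob C. \<forall>X \<in> Ob C. \<forall>f \<in> hom C (A \<^bold>\<times>\<^bsub>C\<^esub> X) X.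
      tangent_map C (Fix A X f) =
        Fix (tangent_ob C A) (tangent_ob C X) (tangent_map C f \<^bold>\<circ>\<^bsub>C\<^esub> interchange C A A X X))"

text \<open>Below, \<open>p\<^sub>1\<close>, \<open>p\<^sub>2\<close>, \<open>p\<^sub>3\<close> are the projections from \<open>(A \<times> A) \<times> X\<close>, and the quadruple is
  bracketed to land in \<open>(A \<times> X) \<times> (A \<times> X)\<close>, the domain of \<open>D f\<close>.\<close>

definition strong_differential_fixpoint_rule ::
  "('o, 'm, 'x) differential_category_scheme \<Rightarrow> ('o \<Rightarrow> 'o \<Rightarrow> 'm \<Rightarrow> 'm) \<Rightarrow> bool" where
  "strong_differential_fixpoint_rule C Fix \<longleftrightarrow>
    (\<forall>A \<in> Ob C. \<forall>X \<in> Ob C. \<forall>f \<in> hom C (A \<^bold>\<times>\<^bsub>C\<^esub> X) X.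
      let p\<^sub>1 = \<pi>\<^sub>1\<^bsub>C\<^esub> A A \<^bold>\<circ>\<^bsub>C\<^esub> \<pi>\<^sub>1\<^bsub>C\<^esub> (A \<^bold>\<times>\<^bsub>C\<^esub> A) X;
          p\<^sub>2 = \<pi>\<^sub>2\<^bsub>C\<^esub> A A \<^bold>\<circ>\<^bsub>C\<^esub> \<pi>\<^sub>1\<^bsub>C\<^esub> (A \<^bold>\<times>\<^bsub>C\<^esub> A) X;
          p\<^sub>3 = \<pi>\<^sub>2\<^bsub>C\<^esub> (A \<^bold>\<times>\<^bsub>C\<^esub> A) X
      in \<^bold>D\<^bsub>C\<^esub> (Fix A X f) =
          Fix (A \<^bold>\<times>\<^bsub>C\<^esub> A) X
            (\<^bold>D\<^bsub>C\<^esub> f \<^bold>\<circ>\<^bsub>C\<^esub>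
              \<langle>\<langle>p\<^sub>1, Fix A X f \<^bold>\<circ>\<^bsub>C\<^esub> p\<^sub>1\<rangle>\<^bsub>C\<^esub>, \<langle>p\<^sub>2, p\<^sub>3\<rangle>\<^bsub>C\<^esub>\<rangle>\<^bsub>C\<^esub>))"

end

theory Submission imports Defs begin

text \<open>
  Written in components, \<open>T f \<circ> c\<close> is the system of two equations
  \<open>x = f (a, x)\<close> and \<open>y = D f ((a, x), (b, y))\<close> in the unknowns \<open>(x, y)\<close> with parameters
  \<open>(a, b)\<close>. This system is triangular: the first equation does not involve \<open>y\<close>. For triangular
  systems the Bekic identity is successive substitution: first solve for \<open>x\<close>, then insert
  the solution into the second equation and solve for \<open>y\<close>
  (\<open>Fix_triangular_system\<close>). Here the first equation does not involve \<open>b\<close> either, so by naturality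
  its solution is \<open>fix f \<circ> \<pi>\<^sub>1\<close>, and the solution for \<open>y\<close> is the right-hand side of the strong
  differential-fixpoint rule (\<open>Fix_tangent_map\<close>). Hence in every Cartesian differential category
  with a Conway operator, for each single \<open>f\<close>,
  \<open>fix (T f \<circ> c) = \<langle>fix f \<circ> \<pi>\<^sub>1, S\<rangle>\<close>, where \<open>S\<close> is that right-hand side.
  Since \<open>T (fix f) = \<langle>fix f \<circ> \<pi>\<^sub>1, D (fix f)\<rangle>\<close>, each of the three rules says
  \<open>D (fix f) = S\<close>.
\<close>

text \<open>
  The axioms are given with typing premises \<open>f \<in> hom C A B\<close>, in which the intermediate objects of
  a composite would have to be guessed. In terms of \<open>Arr\<close>, \<open>Dom\<close> and \<open>Cod\<close> they become conditional
  rewrite rules whose premises the simplifier discharges by computing domains and codomains.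
\<close>

context category
begin

lemma Ident_typing [simp]:
  assumes "A \<in> Ob C"
  shows "\<one> A \<in> Arr C" "Dom C (\<one> A) = A" "Cod C (\<one> A) = A"
  using Ident_hom[OF assms] by (auto simp: hom_def)

lemma Comp_typing [simp]:
  assumes "f \<in> Arr C" "g \<in> Arr C" "Cod C f = Dom C g"
  shows "g \<^bold>\<circ> f \<in> Arr C" "Dom C (g \<^bold>\<circ> f) = Dom C f" "Cod C (g \<^bold>\<circ> f) = Cod C g"
  using Comp_hom[of f "Dom C f" "Dom C g" g "Cod C g"] assms by (auto simp: hom_def)

lemma Comp_Ident_Dom [simp]: "\<lbrakk>f \<in> Arr C; Dom C f = A\<rbrakk> \<Longrightarrow> f \<^bold>\<circ> \<one> A = f"
  using Comp_Ident[of f A "Cod C f"] by (simp add: hom_def)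

lemma Ident_Cod_Comp [simp]: "\<lbrakk>f \<in> Arr C; Cod C f = B\<rbrakk> \<Longrightarrow> \<one> B \<^bold>\<circ> f = f"
  using Ident_Comp[of f "Dom C f" B] by (simp add: hom_def)

lemma Comp_assoc_Dom_Cod [simp]:
  "\<lbrakk>f \<in> Arr C; g \<in> Arr C; h \<in> Arr C; Cod C f = Dom C g; Cod C g = Dom C h\<rbrakk>
    \<Longrightarrow> (h \<^bold>\<circ> g) \<^bold>\<circ> f = h \<^bold>\<circ> (g \<^bold>\<circ> f)"
  using Comp_assoc[of f "Dom C f" "Dom C g" g "Dom C h" h "Cod C h"] by (simp add: hom_def)

end

context category_with_finite_products
begin

lemma Proj_typing [simp]:
  assumes "A \<in> Ob C" "B \<in> Ob C"
  shows "A \<^bold>\<times> B \<in> Ob C"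
    "\<pi>\<^sub>1 A B \<in> Arr C" "Dom C (\<pi>\<^sub>1 A B) = A \<^bold>\<times> B" "Cod C (\<pi>\<^sub>1 A B) = A"
    "\<pi>\<^sub>2 A B \<in> Arr C" "Dom C (\<pi>\<^sub>2 A B) = A \<^bold>\<times> B" "Cod C (\<pi>\<^sub>2 A B) = B"
  using Prod_Ob[OF assms] Proj1_hom[OF assms] Proj2_hom[OF assms] by (auto simp: hom_def)

lemma Pairing_typing [simp]:
  assumes "f \<in> Arr C" "g \<in> Arr C" "Dom C f = Dom C g"
  shows "\<langle>f, g\<rangle> \<in> Arr C" "Dom C \<langle>f, g\<rangle> = Dom C g" "Cod C \<langle>f, g\<rangle> = Cod C f \<^bold>\<times> Cod C g"
  using Pairing_hom[of f "Dom C g" "Cod C f" g "Cod C g"] assms by (auto simp: hom_def)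

lemma Proj_Pairing [simp]:
  assumes "f \<in> Arr C" "g \<in> Arr C" "Dom C f = Dom C g" "Cod C f = A" "Cod C g = B"
  shows "\<pi>\<^sub>1 A B \<^bold>\<circ> \<langle>f, g\<rangle> = f" "\<pi>\<^sub>2 A B \<^bold>\<circ> \<langle>f, g\<rangle> = g"
  using Proj1_Pairing[of f "Dom C g" A g B] Proj2_Pairing[of f "Dom C g" A g B] assms
  by (auto simp: hom_def)

lemma Pairing_Comp [simp]:
  assumes "f \<in> Arr C" "g \<in> Arr C" "h \<in> Arr C" "Dom C f = Dom C g" "Cod C h = Dom C g"
  shows "\<langle>f, g\<rangle> \<^bold>\<circ> h = \<langle>f \<^bold>\<circ> h, g \<^bold>\<circ> h\<rangle>"
proof -
  let ?A = "Cod C f" and ?B = "Cod C g"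
  have obs: "?A \<in> Ob C" "?B \<in> Ob C"
    using assms Cod_Ob by auto
  have "\<langle>f, g\<rangle> \<^bold>\<circ> h = \<langle>\<pi>\<^sub>1 ?A ?B \<^bold>\<circ> (\<langle>f, g\<rangle> \<^bold>\<circ> h), \<pi>\<^sub>2 ?A ?B \<^bold>\<circ> (\<langle>f, g\<rangle> \<^bold>\<circ> h)\<rangle>"
    using Pairing_unique[of ?A ?B "\<langle>f, g\<rangle> \<^bold>\<circ> h" "Dom C h"] obs assms by (simp add: hom_def)
  also have "\<dots> = \<langle>(\<pi>\<^sub>1 ?A ?B \<^bold>\<circ> \<langle>f, g\<rangle>) \<^bold>\<circ> h, (\<pi>\<^sub>2 ?A ?B \<^bold>\<circ> \<langle>f, g\<rangle>) \<^bold>\<circ> h\<rangle>"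
    using obs assms by (simp del: Proj_Pairing)
  also have "\<dots> = \<langle>f \<^bold>\<circ> h, g \<^bold>\<circ> h\<rangle>"
    using assms by simp
  finally show ?thesis .
qed

end

lemma (in parametrized_fixpoint_operator) Fix_typing [simp]:
  assumes "A \<in> Ob C" "X \<in> Ob C" "f \<in> Arr C" "Dom C f = A \<^bold>\<times> X" "Cod C f = X"
  shows "Fix A X f \<in> Arr C" "Dom C (Fix A X f) = A" "Cod C (Fix A X f) = X"
  using Fix_hom[of A X f] assms by (auto simp: hom_def)

text \<open>
  In the Bekic identity the inner fixpoint over \<open>Y\<close> enters the solution for \<open>X\<close> only through the
  first equation. When that equation is \<open>k \<circ> \<pi>\<^sub>1\<close>, the projection discards the inner fixpoint, and
  what is left of the solution for \<open>X\<close> is \<open>fix k\<close>.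
\<close>

lemma (in conway_operator) Fix_triangular_system:
  assumes obs: "A \<in> Ob C" "X \<in> Ob C" "Y \<in> Ob C"
    and k: "k \<in> hom C (A \<^bold>\<times> X) X"
    and g: "g \<in> hom C ((A \<^bold>\<times> X) \<^bold>\<times> Y) Y"
  shows "Fix A (X \<^bold>\<times> Y) (\<langle>k \<^bold>\<circ> \<pi>\<^sub>1 (A \<^bold>\<times> X) Y, g\<rangle> \<^bold>\<circ> assoc_iso C A X Y) =
    \<langle>Fix A X k, Fix A Y (g \<^bold>\<circ> (\<langle>\<one> A, Fix A X k\<rangle> \<^bold>\<otimes> \<one> Y))\<rangle>"
proof -
  have "Fix A X ((k \<^bold>\<circ> \<pi>\<^sub>1 (A \<^bold>\<times> X) Y) \<^bold>\<circ> \<langle>\<one> (A \<^bold>\<times> X), Fix (A \<^bold>\<times> X) Y g\<rangle>) = Fix A X k"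
    using assms by (simp add: hom_def)
  moreover have "k \<^bold>\<circ> \<pi>\<^sub>1 (A \<^bold>\<times> X) Y \<in> hom C ((A \<^bold>\<times> X) \<^bold>\<times> Y) X"
    using assms by (simp add: hom_def)
  ultimately show ?thesis
    using bekic[OF obs _ g] by metis
qed

locale conway_differential_category =
  cartesian_differential_category C + conway_operator C Fix
  for C :: "('o, 'm, 'x) differential_category_scheme" (structure) and Fix
begin

lemma Diff_typing [simp]:
  assumes "f \<in> Arr C"
  shows "\<^bold>D f \<in> Arr C" "Dom C (\<^bold>D f) = Dom C f \<^bold>\<times> Dom C f" "Cod C (\<^bold>D f) = Cod C f"
  using Diff_hom[of f "Dom C f" "Cod C f"] assms by (auto simp: hom_def)

text \<open>The right-hand side of the strong differential-fixpoint rule.\<close>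

definition strong_Fix :: "'o \<Rightarrow> 'o \<Rightarrow> 'm \<Rightarrow> 'm" where
  "strong_Fix A X f =
    (let p\<^sub>1 = \<pi>\<^sub>1 A A \<^bold>\<circ> \<pi>\<^sub>1 (A \<^bold>\<times> A) X;
         p\<^sub>2 = \<pi>\<^sub>2 A A \<^bold>\<circ> \<pi>\<^sub>1 (A \<^bold>\<times> A) X;
         p\<^sub>3 = \<pi>\<^sub>2 (A \<^bold>\<times> A) X
     in Fix (A \<^bold>\<times> A) X (\<^bold>D f \<^bold>\<circ> \<langle>\<langle>p\<^sub>1, Fix A X f \<^bold>\<circ> p\<^sub>1\<rangle>, \<langle>p\<^sub>2, p\<^sub>3\<rangle>\<rangle>))"

lemma strong_Fix_typing [simp]:
  assumes "A \<in> Ob C" "X \<in> Ob C" "f \<in> Arr C" "Dom C f = A \<^bold>\<times> X" "Cod C f = X"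
  shows "strong_Fix A X f \<in> Arr C" "Dom C (strong_Fix A X f) = A \<^bold>\<times> A"
    "Cod C (strong_Fix A X f) = X"
  using assms by (simp_all add: strong_Fix_def Let_def)

text \<open>
  The system \<open>T f \<circ> c\<close> is triangular because the base component \<open>f \<circ> \<pi>\<^sub>1\<close> of \<open>T f\<close> ignores tangent
  vectors; its fibre component \<open>D f\<close>, with the base point fixed at \<open>fix f\<close>, is exactly the map
  whose fixpoint the strong differential-fixpoint rule takes.
\<close>

lemma Fix_tangent_map:
  assumes obs: "A \<in> Ob C" "X \<in> Ob C" and f: "f \<in> hom C (A \<^bold>\<times> X) X"
  shows "Fix (tangent_ob C A) (tangent_ob C X) (tangent_map C f \<^bold>\<circ> interchange C A A X X) =
    \<langle>Fix A X f \<^bold>\<circ> \<pi>\<^sub>1 A A, strong_Fix A X f\<rangle>"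
proof -
  let ?TA = "A \<^bold>\<times> A"
  let ?R = "\<pi>\<^sub>1 (?TA \<^bold>\<times> X) X"
  let ?a = "\<pi>\<^sub>1 A A \<^bold>\<circ> \<pi>\<^sub>1 ?TA X \<^bold>\<circ> ?R"
  let ?b = "\<pi>\<^sub>2 A A \<^bold>\<circ> \<pi>\<^sub>1 ?TA X \<^bold>\<circ> ?R"
  let ?x = "\<pi>\<^sub>2 ?TA X \<^bold>\<circ> ?R"
  let ?y = "\<pi>\<^sub>2 (?TA \<^bold>\<times> X) X"
  \<comment> \<open>The two equations of the system, over the context \<open>((a, b), x)\<close> respectively
      \<open>(((a, b), x), y)\<close>.\<close>
  define k where "k = f \<^bold>\<circ> (\<pi>\<^sub>1 A A \<^bold>\<otimes> \<one> X)"
  define g where "g = \<^bold>D f \<^bold>\<circ> \<langle>\<langle>?a, ?x\<rangle>, \<langle>?b, ?y\<rangle>\<rangle>"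
  have f': "f \<in> Arr C" "Dom C f = A \<^bold>\<times> X" "Cod C f = X"
    using f by (auto simp: hom_def)
  note [simp] = obs f'
  have k: "k \<in> hom C (?TA \<^bold>\<times> X) X"
    by (simp add: k_def prod_map_def hom_def)
  have g: "g \<in> hom C ((?TA \<^bold>\<times> X) \<^bold>\<times> X) X"
    by (simp add: g_def hom_def)
  have system: "tangent_map C f \<^bold>\<circ> interchange C A A X X =
      \<langle>k \<^bold>\<circ> ?R, g\<rangle> \<^bold>\<circ> assoc_iso C ?TA X X"
    by (simp add: tangent_map_def interchange_def assoc_iso_def k_def g_def prod_map_def Let_def)
  have base: "Fix ?TA X k = Fix A X f \<^bold>\<circ> \<pi>\<^sub>1 A A"
    using naturality[of ?TA A X "\<pi>\<^sub>1 A A" f] f by (simp add: k_def hom_def)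
  have fibre: "Fix ?TA X (g \<^bold>\<circ> (\<langle>\<one> ?TA, Fix A X f \<^bold>\<circ> \<pi>\<^sub>1 A A\<rangle> \<^bold>\<otimes> \<one> X)) = strong_Fix A X f"
    by (simp add: g_def prod_map_def strong_Fix_def Let_def)
  show ?thesis
    using Fix_triangular_system[OF _ _ _ k g] by (simp add: tangent_ob_def system base fibre)
qed

lemma differential_fixpoint_rule_iff:
  "differential_fixpoint_rule C Fix \<longleftrightarrow>
    (\<forall>A \<in> Ob C. \<forall>X \<in> Ob C. \<forall>f \<in> hom C (A \<^bold>\<times> X) X. \<^bold>D (Fix A X f) = strong_Fix A X f)"
  unfolding differential_fixpoint_rule_def
  by (intro ball_cong refl) (simp add: Fix_tangent_map, simp add: hom_def)

lemma tangent_fixpoint_rule_iff: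
  "tangent_fixpoint_rule C Fix \<longleftrightarrow>
    (\<forall>A \<in> Ob C. \<forall>X \<in> Ob C. \<forall>f \<in> hom C (A \<^bold>\<times> X) X. \<^bold>D (Fix A X f) = strong_Fix A X f)"
  unfolding tangent_fixpoint_rule_def
proof (intro ball_cong refl)
  fix A X f
  assume obs: "A \<in> Ob C" "X \<in> Ob C" and f: "f \<in> hom C (A \<^bold>\<times> X) X"
  note [simp] = obs
  have [simp]: "f \<in> Arr C" "Dom C f = A \<^bold>\<times> X" "Cod C f = X"
    using f by (auto simp: hom_def)
  have "tangent_map C (Fix A X f) = \<langle>Fix A X f \<^bold>\<circ> \<pi>\<^sub>1 A A, \<^bold>D (Fix A X f)\<rangle>"
    by (simp add: tangent_map_def)
  moreover have "\<pi>\<^sub>2 X X \<^bold>\<circ> \<langle>Fix A X f \<^bold>\<circ> \<pi>\<^sub>1 A A, \<^bold>D (Fix A X f)\<rangle> = \<^bold>D (Fix A X f)"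
    "\<pi>\<^sub>2 X X \<^bold>\<circ> \<langle>Fix A X f \<^bold>\<circ> \<pi>\<^sub>1 A A, strong_Fix A X f\<rangle> = strong_Fix A X f"
    by simp_all
  ultimately show "tangent_map C (Fix A X f) =
      Fix (tangent_ob C A) (tangent_ob C X) (tangent_map C f \<^bold>\<circ> interchange C A A X X) \<longleftrightarrow>
      \<^bold>D (Fix A X f) = strong_Fix A X f"
    using Fix_tangent_map[OF obs f] by metis
qed

lemma strong_differential_fixpoint_rule_iff:
  "strong_differential_fixpoint_rule C Fix \<longleftrightarrow>
    (\<forall>A \<in> Ob C. \<forall>X \<in> Ob C. \<forall>f \<in> hom C (A \<^bold>\<times> X) X. \<^bold>D (Fix A X f) = strong_Fix A X f)"
  by (simp add: strong_differential_fixpoint_rule_def strong_Fix_def Let_def)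

end

theorem proposition4p5:
  fixes C :: "('o, 'm, 'x) differential_category_scheme"
    and Fix :: "'o \<Rightarrow> 'o \<Rightarrow> 'm \<Rightarrow> 'm"
  assumes "cartesian_differential_category C"
    and "conway_operator C Fix"
  shows "(differential_fixpoint_rule C Fix \<longleftrightarrow> tangent_fixpoint_rule C Fix) \<and>
    (tangent_fixpoint_rule C Fix \<longleftrightarrow> strong_differential_fixpoint_rule C Fix)"
proof -
  interpret conway_differential_category C Fix
    using assms by (rule conway_differential_category.intro)
  show ?thesis
    by (simp add: differential_fixpoint_rule_iff tangent_fixpoint_rule_iff
        strong_differential_fixpoint_rule_iff)
qed

end
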